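(* Let $(a_n)_{n\ge1}$ be defined by \[ a_1 = -1, \qquad a_n = -\sum_{r=\lceil n/2\rceil}^{n-1} \binom{r}{n-r} a_r \quad (n \ge 2). \] Then $a_n = (-1)^n C_n$ for all $n\ge 1$, where $C_n$ denotes the $n$-th Catalan number in the indexing $C_{n+1} = \frac{1}{n+1}\binom{2n}{n}$ (so $C_1=1, C_2=1, C_3=2, C_4=5, \dots$). In particular $(a_n)$ grows exponentially. *)

theory Defs
  imports Complex_Main "HOL-Library.Landau_Symbols"
begin

text \<open>The Catalan numbers shifted by one place, so that the values at \<open>1, 2, 3, 4\<close> are
  \<open>1, 1, 2, 5\<close>. The value at \<open>0\<close> is a dummy. Real division is used so that the
  quotient is exact by definition.\<close>

fun catalan :: "nat \<Rightarrow> real" where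
  "catalan 0 = 0"
| "catalan (Suc n) = 1 / (real n + 1) * real ((2 * n) choose n)"

text \<open>Exponential growth in absolute value: the sequence is bounded below and above, up to
  constant factors and from some index on, by geometric sequences of ratio greater than one.
  The Landau sets compare absolute values, so signs play no role.\<close>

definition grows_exponentially :: "(nat \<Rightarrow> real) \<Rightarrow> bool" where
  "grows_exponentially f \<longleftrightarrow>
     (\<exists>b>1. (\<lambda>n. b ^ n) \<in> O(f)) \<and> (\<exists>B>1. f \<in> O(\<lambda>n. B ^ n))"

end

theory Submission
  imports Defs "HOL-Computational_Algebra.Formal_Power_Series"
begin

unbundle fps_syntax

text \<open>
  The signed Catalan series \<open>A = \<Sum> (-1)\<^sup>n C\<^sub>n X\<^sup>n\<close> satisfies the differential equation
  \<open>(1 + 4 X) A' = 2 A - 1\<close>. The coefficients of \<open>B = A (X + X\<^sup>2)\<close> are exactly the sums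
  \<open>\<Sum> (r choose (n - r)) (-1)\<^sup>r C\<^sub>r\<close>. Since \<open>1 + 4 (X + X\<^sup>2) = (1 + 2 X)\<^sup>2\<close>, the equation
  turns into \<open>(1 + 2 X) B' = 2 B - 1\<close>, whose solution vanishing at zero is \<open>B = - X\<close>.
  Hence the signed Catalan numbers satisfy the recurrence. The growth is read off from the
  ratio \<open>C\<^bsub>n+1\<^esub> / C\<^sub>n = (4 n - 2) / (n + 1)\<close>, which lies between 2 and 4 for \<open>n \<ge> 2\<close>.
\<close>

text \<open>With \<open>n = m + 1\<close>, absorption applied twice and the symmetry of row
  \<open>2 * m + 1\<close> reduce the central binomial coefficient of \<open>2 * m + 2\<close> to
  that of \<open>2 * m\<close>. The dummy value at 0 breaks the relation at
  \<open>n = 0\<close>.\<close>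

lemma catalan_rec:
  assumes "n \<ge> 1"
  shows "(real n + 1) * catalan (Suc n) = (4 * real n - 2) * catalan n"
proof -
  obtain m where m: "n = Suc m" using assms by (cases n) auto
  have "Suc m * ((2 * Suc m) choose Suc m) = 2 * Suc m * ((2 * m + 1) choose m)"
    using Suc_times_binomial[of m "2 * m + 1"] by simp
  then have 1: "(2 * Suc m) choose Suc m = 2 * ((2 * m + 1) choose m)"
    by (metis Suc_neq_Zero mult.assoc mult.left_commute mult_left_cancel)
  have "Suc m * ((2 * m + 1) choose Suc m) = Suc (2 * m) * ((2 * m) choose m)"
    using Suc_times_binomial[of m "2 * m"] by simp
  moreover have "(2 * m + 1) choose Suc m = (2 * m + 1) choose m"
    using binomial_symmetric[of m "2 * m + 1"] by simp
  ultimately have "Suc m * ((2 * Suc m) choose Suc m) = 2 * Suc (2 * m) * ((2 * m) choose m)"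
    using 1 by (metis mult.assoc mult.left_commute)
  then have "real (Suc m) * real ((2 * Suc m) choose Suc m)
      = 2 * real (Suc (2 * m)) * real ((2 * m) choose m)"
    by (metis of_nat_mult of_nat_numeral)
  then have 2: "real ((2 * Suc m) choose Suc m)
      = 2 * (2 * real m + 1) * real ((2 * m) choose m) / (real m + 1)"
    by (simp add: field_simps del: binomial_Suc_Suc)
  have "(real n + 1) * catalan (Suc n) = real ((2 * Suc m) choose Suc m)"
    by (simp add: m add_pos_pos del: binomial_Suc_Suc mult_Suc_right)
  also have "\<dots> = (4 * real n - 2) * catalan n"
    unfolding 2 m catalan.simps by (simp add: algebra_simps)
  finally show ?thesis .
qed

definition signed_catalan_fps :: "real fps" where
  "signed_catalan_fps = Abs_fps (\<lambda>n. (-1) ^ n * catalan n)"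

text \<open>For \<open>n \<ge> 1\<close> the coefficients agree by \<open>catalan_rec\<close> up to
  sign; the \<open>- 1\<close> on the right accounts for \<open>n = 0\<close>.\<close>

lemma signed_catalan_fps_ode:
  "(1 + 4 * fps_X) * fps_deriv signed_catalan_fps = 2 * signed_catalan_fps - 1"
proof (rule fps_ext)
  fix n
  show "((1 + 4 * fps_X) * fps_deriv signed_catalan_fps) $ n = (2 * signed_catalan_fps - 1) $ n"
  proof (cases n)
    case 0
    then show ?thesis
      by (simp add: signed_catalan_fps_def distrib_right mult.assoc
          numeral_fps_const fps_mult_left_const_nth)
  next
    case (Suc m)
    then show ?thesis
      using catalan_rec[of "Suc m"]
      by (cases "even m")
        (simp_all add: signed_catalan_fps_def distrib_right mult.assoc numeral_fps_const
          fps_mult_left_const_nth algebra_simps del: catalan.simps)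
  qed
qed

text \<open>Factor \<open>X + X^2 = X (1 + X)\<close> and shift by \<open>i\<close>. For
  \<open>i > n\<close> truncated subtraction would make the binomial 1, while the coefficient is
  0.\<close>

lemma fps_X_plus_square_power_nth:
  fixes i n :: nat
  assumes "i \<le> n"
  shows "((fps_X + fps_X ^ 2 :: real fps) ^ i) $ n = real (i choose (n - i))"
proof -
  have "(fps_X + fps_X ^ 2 :: real fps) ^ i = fps_X ^ i * (1 + fps_X) ^ i"
    by (simp add: power_mult_distrib[symmetric] algebra_simps power2_eq_square)
  then show ?thesis
    using assms by (simp add: fps_X_power_mult_nth fps_binomial_of_nat[symmetric]
        binomial_gbinomial)
qed

lemma signed_catalan_compose:
  "fps_compose signed_catalan_fps (fps_X + fps_X ^ 2) = - fps_X"
proof -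
  let ?u = "fps_X + fps_X ^ 2 :: real fps"
  define B where "B = fps_compose signed_catalan_fps ?u"
  define D where "D = fps_compose (fps_deriv signed_catalan_fps) ?u"
  have u0: "?u $ 0 = 0" by simp
  have "fps_compose ((1 + 4 * fps_X) * fps_deriv signed_catalan_fps) ?u
      = fps_compose (2 * signed_catalan_fps - 1) ?u"
    by (simp add: signed_catalan_fps_ode)
  then have 1: "(1 + 4 * ?u) * D = 2 * B - 1"
    by (simp add: B_def D_def fps_compose_mult_distrib[OF u0] fps_compose_add_distrib
        fps_compose_sub_distrib numeral_fps_const)
  have "fps_deriv B = D * (1 + 2 * fps_X)"
    by (simp add: B_def D_def fps_compose_deriv[OF u0] fps_deriv_power numeral_fps_const)
  \<comment> \<open>One factor of \<open>(1 + 2 X)^2 = 1 + 4 * ?u\<close> is absorbed by the chain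
    rule, the other stays in front.\<close>
  then have ode: "(1 + 2 * fps_X) * fps_deriv B = 2 * B - 1"
    using 1 by (simp add: algebra_simps power2_eq_square)
  have step: "real (Suc n) * B $ Suc n + 2 * real n * B $ n = 2 * B $ n - (if n = 0 then 1 else 0)"
    for n
    using arg_cong[OF ode, of "\<lambda>f. f $ n"]
    by (cases n) (simp_all add: distrib_right mult.assoc numeral_fps_const fps_mult_left_const_nth)
  have b0: "B $ 0 = 0" by (simp add: B_def signed_catalan_fps_def)
  have b1: "B $ 1 = -1" using step[of 0] b0 by simp
  \<comment> \<open>In \<open>step[of 1]\<close> the two terms in \<open>B $ 1\<close> cancel, so
    \<open>B $ 2 = 0\<close>; afterwards each coefficient is a multiple of the one before.\<close>
  have bn: "B $ (Suc (Suc n)) = 0" for n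
  proof (induction n)
    case 0
    then show ?case using step[of 1] b1 by simp
  next
    case (Suc n)
    then show ?case using step[of "Suc (Suc n)"] by simp
  qed
  have "B = - fps_X"
  proof (rule fps_ext)
    fix n
    show "B $ n = (- fps_X) $ n"
    proof (cases "n \<le> 1")
      case True
      then show ?thesis using b0 b1 by (auto simp: le_Suc_eq)
    next
      case False
      then have "n = Suc (Suc (n - 2))" by simp
      then have "B $ n = 0" using bn by metis
      then show ?thesis using False by simp
    qed
  qed
  then show ?thesis by (simp add: B_def)
qed

lemma signed_catalan_sum_eq_0:
  assumes "n \<ge> 2"
  shows "(\<Sum>r = nat \<lceil>real n / 2\<rceil>..n. real (r choose (n - r)) * ((-1) ^ r * catalan r)) = 0"
proof -
  have "(\<Sum>r = nat \<lceil>real n / 2\<rceil>..n. real (r choose (n - r)) * ((-1) ^ r * catalan r))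
      = (\<Sum>r = 0..n. real (r choose (n - r)) * ((-1) ^ r * catalan r))"
  proof (rule sum.mono_neutral_left)
    show "\<forall>i\<in>{0..n} - {nat \<lceil>real n / 2\<rceil>..n}. real (i choose (n - i)) * ((-1) ^ i * catalan i) = 0"
    proof
      fix i assume "i \<in> {0..n} - {nat \<lceil>real n / 2\<rceil>..n}"
      \<comment> \<open>Below half of \<open>n\<close> the lower binomial index exceeds the upper
        one.\<close>
      then have "i < n - i" by auto
      then show "real (i choose (n - i)) * ((-1) ^ i * catalan i) = 0" by simp
    qed
  qed auto
  also have "\<dots> = fps_compose signed_catalan_fps (fps_X + fps_X ^ 2) $ n"
    by (simp add: fps_compose_nth fps_X_plus_square_power_nth signed_catalan_fps_def mult.commute)
  also have "\<dots> = 0"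
    using assms by (simp add: signed_catalan_compose)
  finally show ?thesis .
qed

lemma catalan_nonneg: "catalan n \<ge> 0"
  by (cases n) auto

lemma catalan_le: "catalan n \<le> 4 ^ n"
proof (induction n)
  case (Suc n)
  show ?case
  proof (cases "n = 0")
    case False
    have "(real n + 1) * catalan (Suc n) \<le> (real n + 1) * (4 * catalan n)"
      using False catalan_rec[of n] catalan_nonneg[of n] by (simp add: algebra_simps)
    then have "catalan (Suc n) \<le> 4 * catalan n"
      by (rule mult_left_le_imp_le) simp
    then show ?thesis using Suc by simp
  qed simp
qed simp

text \<open>The constant 4 gives equality at \<open>n = 2\<close>, the first index from which the
  ratio of consecutive values is at least 2.\<close>

lemma catalan_ge:
  assumes "n \<ge> 2"
  shows "2 ^ n \<le> 4 * catalan n"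
  using assms
proof (induction n rule: dec_induct)
  case base
  then show ?case by (simp add: numeral_2_eq_2)
next
  case (step n)
  have "(real n + 1) * (2 * catalan n) \<le> (4 * real n - 2) * catalan n"
    using step(1) catalan_nonneg[of n] mult_right_mono[of "2 * (real n + 1)" "4 * real n - 2" "catalan n"]
    by (simp add: algebra_simps)
  also have "\<dots> = (real n + 1) * catalan (Suc n)"
    using catalan_rec[of n] step(1) by simp
  finally have "2 * catalan n \<le> catalan (Suc n)"
    by (rule mult_left_le_imp_le) simp
  then show ?case using step.IH by simp
qed

theorem theorem2:
  fixes a :: "nat \<Rightarrow> real"
  assumes "a 1 = -1"
    and "\<And>n. n \<ge> 2 \<Longrightarrow>
           a n = - (\<Sum>r = nat \<lceil>real n / 2\<rceil>..n - 1. real (r choose (n - r)) * a r)"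
  shows "(\<forall>n\<ge>1. a n = (-1) ^ n * catalan n) \<and> grows_exponentially a"
proof
  have eq: "n \<ge> 1 \<Longrightarrow> a n = (-1) ^ n * catalan n" for n
  proof (induction n rule: less_induct)
    case (less n)
    show ?case
    proof (cases "n = 1")
      case True
      then show ?thesis using assms(1) by simp
    next
      case False
      then have n: "n \<ge> 2" using less.prems by simp
      let ?m = "nat \<lceil>real n / 2\<rceil>" and ?f = "\<lambda>r. real (r choose (n - r)) * ((-1) ^ r * catalan r)"
      \<comment> \<open>The lower bound keeps index 0, where \<open>a\<close> is unconstrained, out
        of the sum.\<close>
      have m: "1 \<le> ?m" "?m \<le> n" using n by linarith+
      have "a n = - (\<Sum>r = ?m..n - 1. real (r choose (n - r)) * a r)"
        by (rule assms(2)[OF n])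
      also have "\<dots> = - sum ?f {?m..n - 1}"
        using less.IH m n by (intro arg_cong[where f = uminus] sum.cong) auto
      also have "\<dots> = (-1) ^ n * catalan n"
      proof -
        \<comment> \<open>The term at \<open>r = n\<close> has binomial factor 1, so the vanishing
          of the full sum isolates it.\<close>
        have "{?m..n} = insert n {?m..n - 1}" using m n by auto
        then have "sum ?f {?m..n} = ?f n + sum ?f {?m..n - 1}"
          using n by simp
        then show ?thesis using signed_catalan_sum_eq_0[OF n] by simp
      qed
      finally show ?thesis .
    qed
  qed
  then show "\<forall>n\<ge>1. a n = (-1) ^ n * catalan n" by blast
  have abs_a: "\<bar>a n\<bar> = catalan n" if "n \<ge> 1" for n
    using eq[OF that] catalan_nonneg[of n] by (simp add: abs_mult power_abs)
  have "(\<lambda>n. 2 ^ n) \<in> O(a)"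
    using catalan_ge abs_a
    by (intro bigoI[of _ 4] eventually_mono[OF eventually_ge_at_top[of 2]]) simp
  moreover have "a \<in> O(\<lambda>n. 4 ^ n)"
    using catalan_le abs_a
    by (intro bigoI[of _ 1] eventually_mono[OF eventually_ge_at_top[of 1]]) simp
  ultimately show "grows_exponentially a"
    unfolding grows_exponentially_def by (intro conjI exI[of _ 2] exI[of _ 4]) simp_all
qed

end
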